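(* Let $N \ge 2$ be an integer, let $\mathcal{H}_N$ be an $N$-dimensional complex Hilbert space with identity operator $\hat{\mathbb{I}}_N$, and let $\hat{\lambda}_1,\ldots,\hat{\lambda}_{N^2-1} \in \mathcal{L}(\mathcal{H}_N)$ be (orthogonal) generators of $SU(N)$, i.e. operators with $\hat{\lambda}_i = \hat{\lambda}_i^\dagger$, $\operatorname{Tr}\hat{\lambda}_i = 0$ and $\operatorname{Tr}\hat{\lambda}_i\hat{\lambda}_j = 2\delta_{ij}$ for all $i,j$. For ${\bm\lambda} = (\lambda_1,\ldots,\lambda_{N^2-1}) \in \mathbb{R}^{N^2-1}$ put $$\hat{\rho}({\bm\lambda}) = \frac{1}{N}\hat{\mathbb{I}}_N + \frac{1}{2}\sum_{i=1}^{N^2-1}\lambda_i\hat{\lambda}_i ,$$ and define $a_0({\bm\lambda}) = 1, a_1({\bm\lambda}),\ldots,a_N({\bm\lambda})$ by $$\det\big(x\hat{\mathbb{I}}_N - \hat{\rho}({\bm\lambda})\big) = \sum_{j=0}^{N} (-1)^j a_j({\bm\lambda})\, x^{N-j}.$$ Define $$B(\mathbb{R}^{N^2-1}) = \{ {\bm\lambda} \in \mathbb{R}^{N^2-1} : a_i({\bm\lambda}) \ge 0 \ (i=1,\ldots,N)\}.$$ Then the map ${\bm\lambda} \mapsto \hat{\rho}({\bm\lambda})$ is a bijection from $B(\mathbb{R}^{N^2-1})$ onto the density-matrix space $\mathcal{L}_{+,1}(\mathcal{H}_N)$.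
   Context: $\mathcal{L}(\mathcal{H}_N)$ denotes the set of linear operators on $\mathcal{H}_N \simeq \mathbb{C}^N$. The density-matrix space is $$\mathcal{L}_{+,1}(\mathcal{H}_N) = \{\hat{\rho} \in \mathcal{L}(\mathcal{H}_N) : \operatorname{Tr}\hat{\rho} = 1,\ \hat{\rho} = \hat{\rho}^\dagger,\ \rho_i \ge 0 \ (i=1,\ldots,N)\},$$ where $\rho_1,\ldots,\rho_N$ are the eigenvalues of $\hat{\rho}$. *)

theory Defs
  imports "Jordan_Normal_Form.Char_Poly" "Jordan_Normal_Form.Schur_Decomposition"
begin

text \<open>
  Operators on \<open>\<complex>\<^sup>N\<close> are represented by elements of \<open>carrier_mat N N\<close> over the complex numbers,
  and the Hilbert-space adjoint by \<^const>\<open>mat_adjoint\<close>. Points of \<open>\<real>\<^sup>m\<close> are elements of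
  \<open>carrier_vec m\<close>; all indices into them start at 0.

  The order on the complex numbers is the one of \<^theory>\<open>HOL-Library.Complex_Order\<close>:
  \<open>0 \<le> z\<close> means that \<open>z\<close> is real and nonnegative.
\<close>

definition mat_trace :: "'a :: comm_monoid_add mat \<Rightarrow> 'a" where
  "mat_trace A = (\<Sum>i<dim_row A. A $$ (i, i))"

definition bloch_operator :: "nat \<Rightarrow> (nat \<Rightarrow> complex mat) \<Rightarrow> real vec \<Rightarrow> complex mat" where
  "bloch_operator N \<Lambda> v =
     (1 / of_nat N) \<cdot>\<^sub>m 1\<^sub>m N +
     (1 / 2) \<cdot>\<^sub>m (\<Oplus>\<^bsub>module_mat TYPE(complex) N N\<^esub>i\<in>{..<N\<^sup>2 - 1}. complex_of_real (v $ i) \<cdot>\<^sub>m \<Lambda> i)"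

text \<open>
  The number \<open>a\<^sub>j\<close> in \<open>det (x I - A) = (\<Sum>j\<le>n. (-1)\<^sup>j a\<^sub>j x\<^sup>n\<^sup>-\<^sup>j)\<close>, for an \<open>n \<times> n\<close> matrix \<open>A\<close> and \<open>j \<le> n\<close>.
\<close>

definition char_poly_sgn_coeff :: "complex mat \<Rightarrow> nat \<Rightarrow> complex" where
  "char_poly_sgn_coeff A j = (- 1) ^ j * coeff (char_poly A) (dim_row A - j)"

lemma det_eq_sum_char_poly_sgn_coeff:
  assumes A: "A \<in> carrier_mat n n"
  shows "det (x \<cdot>\<^sub>m 1\<^sub>m n - A) = (\<Sum>j\<le>n. (- 1) ^ j * char_poly_sgn_coeff A j * x ^ (n - j))"
proof -
  have "x \<cdot>\<^sub>m 1\<^sub>m n - A = - char_matrix A x"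
    using A by (intro eq_matI) (auto simp: char_matrix_def)
  hence "det (x \<cdot>\<^sub>m 1\<^sub>m n - A) = poly (char_poly A) x"
    by (simp add: char_poly_matrix[OF A])
  also have "\<dots> = (\<Sum>i\<le>n. coeff (char_poly A) i * x ^ i)"
    using degree_monic_char_poly[OF A] by (simp add: poly_altdef)
  also have "\<dots> = (\<Sum>j\<le>n. coeff (char_poly A) (n - j) * x ^ (n - j))"
    by (rule sum.reindex_bij_witness[of _ "\<lambda>j. n - j" "\<lambda>j. n - j"]) auto
  also have "\<dots> = (\<Sum>j\<le>n. (- 1) ^ j * char_poly_sgn_coeff A j * x ^ (n - j))"
    using A by (simp add: char_poly_sgn_coeff_def flip: mult.assoc power_add)
  finally show ?thesis .
qed

definition nonneg_coeff_set :: "nat \<Rightarrow> (nat \<Rightarrow> complex mat) \<Rightarrow> real vec set" where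
  "nonneg_coeff_set N \<Lambda> =
     {v \<in> carrier_vec (N\<^sup>2 - 1). \<forall>i\<in>{1..N}. 0 \<le> char_poly_sgn_coeff (bloch_operator N \<Lambda> v) i}"

definition density_matrices :: "nat \<Rightarrow> complex mat set" where
  "density_matrices N =
     {\<rho> \<in> carrier_mat N N. mat_trace \<rho> = 1 \<and> \<rho> = mat_adjoint \<rho> \<and> (\<forall>e. eigenvalue \<rho> e \<longrightarrow> 0 \<le> e)}"

end

theory Submission
  imports Defs
begin

text \<open>
  The operators \<open>\<lambda>\<^sub>i\<close> together with the identity are \<open>N\<^sup>2\<close> operators that are orthogonal for the trace
  form, so they span all operators: the Gram relations say that a matrix of size \<open>N\<^sup>2\<close> has a right
  inverse, and the fact that it is also a left inverse is the completeness relation. Hence a Hermitian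
  operator of trace one is \<open>\<rho>(\<lambda>)\<close> for exactly one real \<open>\<lambda>\<close>, with \<open>\<lambda>\<^sub>i = Tr (\<rho> \<lambda>\<^sub>i)\<close>.
  A Hermitian operator has real eigenvalues. If they are nonnegative, so are their elementary symmetric
  functions \<open>a\<^sub>i\<close>; conversely, if all \<open>a\<^sub>i \<ge> 0\<close>, then at \<open>x < 0\<close> every term of
  \<open>\<Sum>\<^sub>j (-1)\<^sup>j a\<^sub>j x\<^sup>N\<^sup>-\<^sup>j\<close> has the sign \<open>(-1)\<^sup>N\<close> and the leading one is nonzero, so \<open>x\<close> is not an eigenvalue.
\<close>

section \<open>Trace and adjoint\<close>

lemma mat_trace_mult:
  assumes "A \<in> carrier_mat n m" "B \<in> carrier_mat m n"
  shows "mat_trace (A * B) = (\<Sum>i<n. \<Sum>j<m. A $$ (i, j) * B $$ (j, i))"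
  using assms by (auto simp: mat_trace_def scalar_prod_def lessThan_atLeast0 intro!: sum.cong)

lemma mat_trace_smult:
  fixes c :: "'a :: comm_semiring_0"
  shows "A \<in> carrier_mat n n \<Longrightarrow> mat_trace (c \<cdot>\<^sub>m A) = c * mat_trace A"
  by (auto simp: mat_trace_def sum_distrib_left)

lemma mat_trace_one: "mat_trace (1\<^sub>m n :: 'a :: semiring_1 mat) = of_nat n"
  by (simp add: mat_trace_def)

lemma hermitian_iff:
  fixes A :: "complex mat"
  assumes A: "A \<in> carrier_mat n n"
  shows "A = mat_adjoint A \<longleftrightarrow> (\<forall>i<n. \<forall>j<n. A $$ (i, j) = cnj (A $$ (j, i)))"
proof -
  have adj: "mat_adjoint A \<in> carrier_mat n n"
    and adj_index: "\<And>i j. i < n \<Longrightarrow> j < n \<Longrightarrow> mat_adjoint A $$ (i, j) = cnj (A $$ (j, i))"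
    using A by (auto simp: mat_adjoint_def mat_of_rows_def)
  have "A = mat_adjoint A \<longleftrightarrow> (\<forall>i<n. \<forall>j<n. A $$ (i, j) = mat_adjoint A $$ (i, j))"
    using A adj by (metis carrier_matD eq_matI)
  thus ?thesis
    using adj_index by simp
qed

lemma hermitian_index:
  fixes A :: "complex mat"
  assumes "A \<in> carrier_mat n n" "A = mat_adjoint A" "i < n" "j < n"
  shows "cnj (A $$ (i, j)) = A $$ (j, i)"
  using hermitian_iff[OF assms(1)] assms(2-4) by (metis complex_cnj_cnj)

text \<open>For an eigenvector \<open>v\<close>, both \<open>s\<close>, its squared norm, and
  \<open>e * s\<close>, the value of the quadratic form of \<open>A\<close> at \<open>v\<close>, are
  fixed by conjugation, and \<open>s\<close> is nonzero.\<close>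

lemma hermitian_eigenvalue_real:
  fixes A :: "complex mat"
  assumes A: "A \<in> carrier_mat n n" and herm: "A = mat_adjoint A" and ev: "eigenvalue A e"
  shows "e \<in> \<real>"
proof -
  from ev A obtain v where v: "v \<in> carrier_vec n" "v \<noteq> 0\<^sub>v n" and Av: "A *\<^sub>v v = e \<cdot>\<^sub>v v"
    by (auto simp: eigenvalue_def eigenvector_def)
  define s where "s = (\<Sum>i<n. v $ i * cnj (v $ i))"
  have s: "s = v \<bullet>c v"
    using v by (auto simp: s_def scalar_prod_def lessThan_atLeast0 intro!: sum.cong)
  have "s \<noteq> 0"
    unfolding s using v by simp
  have cs: "cnj s = s"
    by (simp add: s_def mult.commute)
  have "e * s = (\<Sum>i<n. (A *\<^sub>v v) $ i * cnj (v $ i))"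
    using v by (simp add: Av s_def sum_distrib_left mult.assoc)
  also have "\<dots> = (\<Sum>i<n. \<Sum>j<n. A $$ (i, j) * v $ j * cnj (v $ i))"
    using A v by (auto simp: scalar_prod_def lessThan_atLeast0 sum_distrib_right intro!: sum.cong)
  finally have es: "e * s = (\<Sum>i<n. \<Sum>j<n. A $$ (i, j) * v $ j * cnj (v $ i))" .
  have "cnj (e * s) = (\<Sum>i<n. \<Sum>j<n. A $$ (j, i) * cnj (v $ j) * v $ i)"
    unfolding es by (simp add: hermitian_index[OF A herm])
  also have "\<dots> = e * s"
    unfolding es by (subst sum.swap) (simp add: mult_ac)
  finally show ?thesis
    using cs \<open>s \<noteq> 0\<close> by (simp add: Reals_cnj_iff)
qed

text \<open>Conjugation exchanges the two summation indices of the trace. This makes the Bloch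
  coordinates of a Hermitian operator real.\<close>

lemma mat_trace_hermitian_mult_real:
  fixes A B :: "complex mat"
  assumes A: "A \<in> carrier_mat n n" "A = mat_adjoint A"
    and B: "B \<in> carrier_mat n n" "B = mat_adjoint B"
  shows "mat_trace (A * B) \<in> \<real>"
proof -
  have "cnj (mat_trace (A * B)) = (\<Sum>i<n. \<Sum>j<n. A $$ (j, i) * B $$ (i, j))"
    unfolding mat_trace_mult[OF A(1) B(1)]
    by (simp add: hermitian_index[OF A] hermitian_index[OF B])
  also have "\<dots> = mat_trace (A * B)"
    unfolding mat_trace_mult[OF A(1) B(1)] by (rule sum.swap)
  finally show ?thesis
    by (simp add: Reals_cnj_iff)
qed

section \<open>Completeness of dual families\<close>

text \<open>Duality says that \<open>M * W = 1\<close> for two square matrices of size n^2; reading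
  \<open>W * M = 1\<close> entrywise turns it into the expansion of any operator in the family
  \<open>G\<close>.\<close>

lemma trace_dual_expansion:
  fixes G H :: "nat \<Rightarrow> 'a :: field mat"
  assumes G: "\<And>k. k < n\<^sup>2 \<Longrightarrow> G k \<in> carrier_mat n n"
    and H: "\<And>k. k < n\<^sup>2 \<Longrightarrow> H k \<in> carrier_mat n n"
    and dual: "\<And>k l. k < n\<^sup>2 \<Longrightarrow> l < n\<^sup>2 \<Longrightarrow> mat_trace (G k * H l) = (if k = l then 1 else 0)"
    and A: "A \<in> carrier_mat n n" and i: "i < n" and j: "j < n"
  shows "A $$ (i, j) = (\<Sum>k<n\<^sup>2. mat_trace (A * H k) * G k $$ (i, j))"
proof -
  let ?P = "{..<n} \<times> {..<n}"
  \<comment> \<open>The bijection \<open>e\<close> numbers the matrix positions, so that an operator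
    becomes a vector of length n^2.\<close>
  have "card {..<n\<^sup>2} = card ?P"
    by (simp add: power2_eq_square)
  then obtain e where e: "bij_betw e {..<n\<^sup>2} ?P"
    using finite_same_card_bij[of "{..<n\<^sup>2}" ?P] by auto
  have e_ex: "\<exists>p<n\<^sup>2. e p = x" if "x \<in> ?P" for x
  proof -
    have "x \<in> e ` {..<n\<^sup>2}"
      using that bij_betw_imp_surj_on[OF e] by blast
    thus ?thesis by blast
  qed
  define M where "M = mat (n\<^sup>2) (n\<^sup>2) (\<lambda>(k, p). G k $$ e p)"
  \<comment> \<open>The trace of a product pairs position (i, j) of one factor with (j, i) of the
    other; the swap turns this pairing into an ordinary row-by-column product.\<close>
  define W where "W = mat (n\<^sup>2) (n\<^sup>2) (\<lambda>(p, k). H k $$ prod.swap (e p))"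
  have M: "M \<in> carrier_mat (n\<^sup>2) (n\<^sup>2)" and W: "W \<in> carrier_mat (n\<^sup>2) (n\<^sup>2)"
    by (auto simp: M_def W_def)
  have "(M * W) $$ (k, l) = (if k = l then 1 else 0)" if kl: "k < n\<^sup>2" "l < n\<^sup>2" for k l
  proof -
    have "(M * W) $$ (k, l) = (\<Sum>p<n\<^sup>2. G k $$ e p * H l $$ prod.swap (e p))"
      using kl by (auto simp: M_def W_def scalar_prod_def lessThan_atLeast0 intro!: sum.cong)
    also have "\<dots> = (\<Sum>x\<in>?P. G k $$ x * H l $$ prod.swap x)"
      by (rule sum.reindex_bij_betw[OF e])
    also have "\<dots> = mat_trace (G k * H l)"
      by (simp add: mat_trace_mult[OF G[OF kl(1)] H[OF kl(2)]] sum.cartesian_product case_prod_unfold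
          prod.swap_def)
    finally show ?thesis
      using dual[OF kl] by simp
  qed
  hence "M * W = 1\<^sub>m (n\<^sup>2)"
    using M W by (intro eq_matI) auto
  hence WM: "W * M = 1\<^sub>m (n\<^sup>2)"
    by (rule mat_mult_left_right_inverse[OF M W])
  have complete: "(\<Sum>k<n\<^sup>2. H k $$ prod.swap x * G k $$ y) = (if x = y then 1 else 0)"
    if xy: "x \<in> ?P" "y \<in> ?P" for x y
  proof -
    obtain p q where p: "p < n\<^sup>2" "e p = x" and q: "q < n\<^sup>2" "e q = y"
      using e_ex[OF xy(1)] e_ex[OF xy(2)] by blast
    have "(\<Sum>k<n\<^sup>2. H k $$ prod.swap x * G k $$ y) = (W * M) $$ (p, q)"
      unfolding p(2)[symmetric] q(2)[symmetric] using p(1) q(1)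
      by (auto simp: M_def W_def scalar_prod_def lessThan_atLeast0 intro!: sum.cong)
    also have "\<dots> = (if p = q then 1 else 0)"
      using p(1) q(1) by (simp add: WM)
    also have "p = q \<longleftrightarrow> x = y"
      using inj_on_eq_iff[OF bij_betw_imp_inj_on[OF e], of p q] p q by simp
    finally show ?thesis .
  qed
  have "(\<Sum>k<n\<^sup>2. mat_trace (A * H k) * G k $$ (i, j))
      = (\<Sum>k<n\<^sup>2. \<Sum>x\<in>?P. A $$ x * (H k $$ prod.swap x * G k $$ (i, j)))"
    using A H by (intro sum.cong refl)
      (simp add: mat_trace_mult[of _ n n] sum.cartesian_product case_prod_unfold
        prod.swap_def sum_distrib_right mult.assoc)
  also have "\<dots> = (\<Sum>x\<in>?P. A $$ x * (\<Sum>k<n\<^sup>2. H k $$ prod.swap x * G k $$ (i, j)))"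
    by (subst sum.swap) (simp add: sum_distrib_left)
  also have "\<dots> = (\<Sum>x\<in>?P. if x = (i, j) then A $$ x else 0)"
    using i j by (intro sum.cong refl) (subst complete; auto)
  also have "\<dots> = A $$ (i, j)"
    using i j by (subst sum.delta) auto
  finally show ?thesis by simp
qed

section \<open>Signs of the coefficients of the characteristic polynomial\<close>

text \<open>Multiplying a polynomial by \<open>[:- e, 1:]\<close> turns its coefficients c(k) into
  c(k-1) - e c(k). After the sign is applied, both summands are nonnegative. The exponent
  \<open>length es + k\<close> has the parity of the difference but avoids truncated
  subtraction.\<close>

lemma coeff_prod_list_nonneg_roots:
  fixes es :: "complex list"
  assumes "\<And>e. e \<in> set es \<Longrightarrow> 0 \<le> e"
  shows "0 \<le> (- 1) ^ (length es + k) * coeff (\<Prod>e\<leftarrow>es. [:- e, 1:]) k"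
  using assms
proof (induction es arbitrary: k)
  case Nil
  then show ?case by (cases k) (auto simp: less_eq_complex_def)
next
  case (Cons e es)
  let ?p = "\<Prod>e\<leftarrow>es. [:- e, 1:]"
  have IH: "0 \<le> (- 1) ^ (length es + k) * coeff ?p k" for k
    using Cons by simp
  have "0 \<le> e * ((- 1) ^ (length es + k) * coeff ?p k)"
    using Cons.prems by (intro mult_nonneg_nonneg[OF _ IH]) simp
  then show ?case
  proof (cases k)
    case 0
    with \<open>0 \<le> e * _\<close> show ?thesis by (simp add: mult_ac)
  next
    case (Suc l)
    with add_nonneg_nonneg[OF \<open>0 \<le> e * _\<close> IH[of l]] show ?thesis
      by (simp add: algebra_simps)
  qed
qed

lemma char_poly_sgn_coeff_nonneg:
  assumes A: "A \<in> carrier_mat n n" and ev: "\<And>e. eigenvalue A e \<Longrightarrow> 0 \<le> e" and "j \<le> n"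
  shows "0 \<le> char_poly_sgn_coeff A j"
proof -
  obtain es where es: "char_poly A = (\<Prod>e\<leftarrow>es. [:- e, 1:])" "length es = n"
    using char_poly_factorized[OF A] by auto
  have "0 \<le> e" if "e \<in> set es" for e
    using that by (intro ev)
      (simp add: eigenvalue_root_char_poly[OF A] es(1) poly_prod_list o_def prod_list_zero_iff)
  from coeff_prod_list_nonneg_roots[of es "n - j", OF this]
  have "0 \<le> (- 1) ^ (n + (n - j)) * coeff (char_poly A) (n - j)"
    by (simp add: es)
  \<comment> \<open>The exponents differ by the even number 2 (n - j).\<close>
  moreover have "(- 1) ^ (n + (n - j)) = ((- 1) ^ j :: complex)"
    using \<open>j \<le> n\<close> by (intro minus_one_power_iff[THEN trans]) (simp add: minus_one_power_iff)
  ultimately show ?thesis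
    using A by (simp add: char_poly_sgn_coeff_def)
qed

lemma eigenvalue_nonneg:
  assumes A: "A \<in> carrier_mat n n" and e: "eigenvalue A e" "e \<in> \<real>"
    and a: "\<And>j. j \<in> {1..n} \<Longrightarrow> 0 \<le> char_poly_sgn_coeff A j"
  shows "0 \<le> e"
proof (rule ccontr)
  assume "\<not> 0 \<le> e"
  \<comment> \<open>The order on the complex numbers is partial: only because \<open>e\<close> is
    real does the negation of \<open>0 \<le> e\<close> mean that \<open>e\<close> is
    negative.\<close>
  with e obtain r where r: "e = - of_real r" "r > 0"
    by (auto simp: Reals_def less_eq_complex_def intro: that[of "- x" for x])
  \<comment> \<open>\<open>t j\<close> is the j-th term of the expansion at \<open>e = - r\<close>
    with the common sign \<open>(- 1) ^ n\<close> removed. Since the polynomial is monic,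
    \<open>t 0 = r ^ n\<close> is strictly positive.\<close>
  define t where "t = (\<lambda>j. char_poly_sgn_coeff A j * of_real r ^ (n - j))"
  have a0: "char_poly_sgn_coeff A 0 = 1"
    using degree_monic_char_poly[OF A] A by (simp add: char_poly_sgn_coeff_def)
  have "0 \<le> (\<Sum>j\<in>{1..n}. t j)"
    using a r
    by (auto simp: t_def less_eq_complex_def simp flip: of_real_power intro!: sum_nonneg mult_nonneg_nonneg)
  moreover have "0 < t 0"
    using r by (simp add: t_def a0 less_complex_def flip: of_real_power)
  moreover have "(\<Sum>j\<le>n. t j) = t 0 + (\<Sum>j\<in>{1..n}. t j)"
    by (simp add: atMost_atLeast0 sum.atLeast_Suc_atMost)
  ultimately have nz: "(\<Sum>j\<le>n. t j) \<noteq> 0"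
    by (metis add_pos_nonneg less_irrefl)
  have sign: "(- 1) ^ j * (- 1) ^ (n - j) = ((- 1) ^ n :: complex)" if "j \<le> n" for j
    using that by (simp flip: power_add)
  have "poly (char_poly A) e = det (e \<cdot>\<^sub>m 1\<^sub>m n - A)"
  proof -
    have "e \<cdot>\<^sub>m 1\<^sub>m n - A = - char_matrix A e"
      using A by (intro eq_matI) (auto simp: char_matrix_def)
    thus ?thesis
      by (simp add: char_poly_matrix[OF A])
  qed
  also have "\<dots> = (\<Sum>j\<le>n. (- 1) ^ n * t j)"
    unfolding det_eq_sum_char_poly_sgn_coeff[OF A]
  proof (intro sum.cong refl)
    fix j assume "j \<in> {..n}"
    have "(- 1) ^ j * char_poly_sgn_coeff A j * e ^ (n - j) = ((- 1) ^ j * (- 1) ^ (n - j)) * t j"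
      by (simp add: r(1) t_def power_minus[of "of_real r"])
    with sign \<open>j \<in> {..n}\<close>
    show "(- 1) ^ j * char_poly_sgn_coeff A j * e ^ (n - j) = (- 1) ^ n * t j" by simp
  qed
  also have "\<dots> \<noteq> 0"
    using nz by (simp flip: sum_distrib_left)
  finally show False
    using e(1) by (simp add: eigenvalue_root_char_poly[OF A])
qed

section \<open>The Bloch parametrization\<close>

text \<open>Reduces the sum in the module of matrices, used by \<open>bloch_operator\<close>, to
  sums of entries.\<close>

lemma finsum_mat_index:
  fixes F :: "'b \<Rightarrow> 'a :: comm_ring_1 mat"
  assumes "finite S" and "\<And>k. k \<in> S \<Longrightarrow> F k \<in> carrier_mat m n"
  shows "(\<Oplus>\<^bsub>module_mat TYPE('a) m n\<^esub>k\<in>S. F k) = mat m n (\<lambda>ij. \<Sum>k\<in>S. F k $$ ij)"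
proof -
  interpret abelian_group "module_mat TYPE('a) m n"
    by (rule abelian_group_mat)
  from assms show ?thesis
  proof (induction S rule: finite_induct)
    case empty
    then show ?case by (auto simp: module_mat_simps)
  next
    case (insert k S)
    then have "F k + mat m n (\<lambda>ij. \<Sum>k\<in>S. F k $$ ij)
        = mat m n (\<lambda>ij. \<Sum>k\<in>insert k S. F k $$ ij)"
      by (intro eq_matI) auto
    with insert show ?case
      by (subst finsum_insert) (auto simp: module_mat_simps)
  qed
qed

lemma bloch_operator_eq_mat:
  assumes "\<And>i. i < N\<^sup>2 - 1 \<Longrightarrow> \<Lambda> i \<in> carrier_mat N N"
  shows "bloch_operator N \<Lambda> v = mat N N (\<lambda>(r, c). (if r = c then 1 / of_nat N else 0)
    + (\<Sum>i<N\<^sup>2 - 1. of_real (v $ i) / 2 * \<Lambda> i $$ (r, c)))"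
proof -
  have "(c \<cdot>\<^sub>m \<Lambda> i) $$ (r, s) = c * \<Lambda> i $$ (r, s)" if "i < N\<^sup>2 - 1" "r < N" "s < N" for c i r s
    using assms[OF that(1)] that by simp
  thus ?thesis
    unfolding bloch_operator_def using assms
    by (subst finsum_mat_index) (auto intro!: eq_matI sum.cong simp: sum_distrib_left)
qed

theorem theorem1:
  fixes N :: nat and \<Lambda> :: "nat \<Rightarrow> complex mat"
  assumes "N \<ge> 2"
    and "\<And>i. i < N\<^sup>2 - 1 \<Longrightarrow> \<Lambda> i \<in> carrier_mat N N"
    and "\<And>i. i < N\<^sup>2 - 1 \<Longrightarrow> \<Lambda> i = mat_adjoint (\<Lambda> i)"
    and "\<And>i. i < N\<^sup>2 - 1 \<Longrightarrow> mat_trace (\<Lambda> i) = 0"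
    and "\<And>i j. i < N\<^sup>2 - 1 \<Longrightarrow> j < N\<^sup>2 - 1 \<Longrightarrow> mat_trace (\<Lambda> i * \<Lambda> j) = (if i = j then 2 else 0)"
  shows "bij_betw (bloch_operator N \<Lambda>) (nonneg_coeff_set N \<Lambda>) (density_matrices N)"
proof -
  note carr = assms(2) and herm = assms(3) and traceless = assms(4) and orth = assms(5)
  let ?m = "N\<^sup>2 - 1"
  let ?\<rho> = "bloch_operator N \<Lambda>"
  have N: "N > 0" using assms(1) by simp
  have N2: "N\<^sup>2 = Suc ?m" using N by simp
  note \<rho>_eq = bloch_operator_eq_mat[of N \<Lambda>, OF carr]
  have \<rho>: "?\<rho> v \<in> carrier_mat N N" for v
    by (simp add: \<rho>_eq)
  have \<rho>_herm: "?\<rho> v = mat_adjoint (?\<rho> v)" for v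
    unfolding hermitian_iff[OF \<rho>]
    using hermitian_index[OF carr herm]
    by (auto simp: \<rho>_eq intro!: sum.cong)
  \<comment> \<open>Pairing with \<open>B = 1\<^sub>m N\<close> will give trace one, and pairing
    with \<open>\<Lambda> i\<close> will recover the coordinates.\<close>
  have \<rho>_mult: "mat_trace (?\<rho> v * B)
      = mat_trace B / of_nat N + (\<Sum>i<?m. of_real (v $ i) / 2 * mat_trace (\<Lambda> i * B))"
    if B: "B \<in> carrier_mat N N" for v B
  proof -
    have "mat_trace (?\<rho> v * B) = (\<Sum>r<N. \<Sum>c<N. (if r = c then B $$ (c, r) / of_nat N else 0)
        + (\<Sum>i<?m. of_real (v $ i) / 2 * (\<Lambda> i $$ (r, c) * B $$ (c, r))))"
      unfolding mat_trace_mult[OF \<rho> B]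
      by (intro sum.cong refl)
        (simp add: \<rho>_eq distrib_right sum_distrib_right mult.assoc if_distrib[of "\<lambda>x. x * _"])
    also have "\<dots> = (\<Sum>r<N. B $$ (r, r) / of_nat N)
        + (\<Sum>r<N. \<Sum>c<N. \<Sum>i<?m. of_real (v $ i) / 2 * (\<Lambda> i $$ (r, c) * B $$ (c, r)))"
      by (simp add: sum.distrib)
    also have "(\<Sum>r<N. \<Sum>c<N. \<Sum>i<?m. of_real (v $ i) / 2 * (\<Lambda> i $$ (r, c) * B $$ (c, r)))
        = (\<Sum>i<?m. of_real (v $ i) / 2 * (\<Sum>r<N. \<Sum>c<N. \<Lambda> i $$ (r, c) * B $$ (c, r)))"
      unfolding sum_distrib_left by (subst sum.swap[of _ _ "{..<?m}"], subst sum.swap) simp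
    also have "\<dots> = (\<Sum>i<?m. of_real (v $ i) / 2 * mat_trace (\<Lambda> i * B))"
      by (intro sum.cong refl) (simp add: mat_trace_mult[OF carr B])
    also have "(\<Sum>r<N. B $$ (r, r) / of_nat N) = mat_trace B / of_nat N"
      using B by (simp add: mat_trace_def sum_divide_distrib)
    finally show ?thesis .
  qed
  have \<rho>_trace: "mat_trace (?\<rho> v) = 1" for v
    using \<rho>_mult[of "1\<^sub>m N" v] right_mult_one_mat[OF \<rho>] right_mult_one_mat[OF carr] N traceless
    by (simp add: mat_trace_one)
  have \<rho>_coord: "mat_trace (?\<rho> v * \<Lambda> i) = of_real (v $ i)" if "i < ?m" for v i
  proof -
    have "mat_trace (?\<rho> v * \<Lambda> i) = (\<Sum>k<?m. of_real (v $ k) / 2 * (if k = i then 2 else 0))"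
      using that by (simp add: \<rho>_mult[OF carr] traceless orth)
    also have "\<dots> = (\<Sum>k<?m. if k = i then of_real (v $ k) else 0)"
      by (intro sum.cong refl) simp
    also have "\<dots> = of_real (v $ i)"
      using that by simp
    finally show ?thesis .
  qed

  \<comment> \<open>The candidate inverse: the factor 1/2 in the Bloch form cancels against the
    trace 2 of each squared generator. On Hermitian operators \<open>Re\<close> only changes the
    type, since the trace is already real.\<close>
  define coord where "coord A = vec ?m (\<lambda>i. Re (mat_trace (A * \<Lambda> i)))" for A
  have surj: "?\<rho> (coord A) = A"
    if A: "A \<in> carrier_mat N N" "A = mat_adjoint A" "mat_trace A = 1" for A
  proof (rule eq_matI)
    fix r c assume "r < dim_row A" "c < dim_col A"
    hence rc: "r < N" "c < N" using A(1) by auto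
    \<comment> \<open>The last index \<open>?m\<close> holds the identity. The weights 1/2 and 1/N
      in the dual family \<open>H\<close> are the reciprocals of the traces of the squares of the
      members of \<open>G\<close>.\<close>
    define G where "G k = (if k < ?m then \<Lambda> k else 1\<^sub>m N)" for k
    define H where "H k = (if k < ?m then (1 / 2) \<cdot>\<^sub>m \<Lambda> k else (1 / of_nat N) \<cdot>\<^sub>m 1\<^sub>m N)" for k
    have GH: "G k \<in> carrier_mat N N" "H k \<in> carrier_mat N N" for k
      using carr by (auto simp: G_def H_def)
    have trH: "mat_trace (B * H k) = (if k < ?m then mat_trace (B * \<Lambda> k) / 2 else mat_trace B / of_nat N)"
      if "B \<in> carrier_mat N N" for B k
      using that carr by (auto simp: H_def mult_smult_distrib[of _ N N _ N] mat_trace_smult[of _ N])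
    have gram: "mat_trace (G k * H l) = (if k = l then 1 else 0)" if "k < N\<^sup>2" "l < N\<^sup>2" for k l
    proof -
      from that N2 have "k < ?m \<or> k = ?m" "l < ?m \<or> l = ?m" by linarith+
      thus ?thesis
        unfolding trH[OF GH(1)] using N
        by (auto simp: G_def mat_trace_one traceless orth left_mult_one_mat[OF carr])
    qed
    have "A $$ (r, c) = (\<Sum>k<N\<^sup>2. mat_trace (A * H k) * G k $$ (r, c))"
      by (rule trace_dual_expansion[OF GH gram A(1) rc])
    also have "\<dots> = (\<Sum>k<Suc ?m. mat_trace (A * H k) * G k $$ (r, c))"
      by (simp only: N2[symmetric])
    \<comment> \<open>The term at \<open>?m\<close> is the identity component; its coefficient is
      1/N because \<open>A\<close> has trace one.\<close>
    also have "\<dots> = (\<Sum>k<?m. mat_trace (A * \<Lambda> k) / 2 * \<Lambda> k $$ (r, c)) + (if r = c then 1 / of_nat N else 0)"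
      unfolding sum.lessThan_Suc trH[OF A(1)] G_def using rc A(3) by simp
    also have "\<dots> = ?\<rho> (coord A) $$ (r, c)"
      using rc mat_trace_hermitian_mult_real[OF A(1,2) carr herm]
      by (auto simp: \<rho>_eq coord_def intro!: sum.cong)
    finally show "?\<rho> (coord A) $$ (r, c) = A $$ (r, c)" by simp
  qed (use A(1) \<rho> in auto)

  have densityD: "A \<in> carrier_mat N N" "A = mat_adjoint A" "mat_trace A = 1"
    "\<And>e. eigenvalue A e \<Longrightarrow> 0 \<le> e" if "A \<in> density_matrices N" for A
    using that unfolding density_matrices_def by blast+

  show ?thesis
  proof (rule bij_betwI[where g = coord])
    \<comment> \<open>Trace one and Hermiticity hold for every \<open>v\<close>; the coefficient
      signs serve only to make the real eigenvalues nonnegative.\<close>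
    show "?\<rho> \<in> nonneg_coeff_set N \<Lambda> \<rightarrow> density_matrices N"
    proof
      fix v assume "v \<in> nonneg_coeff_set N \<Lambda>"
      hence "0 \<le> e" if "eigenvalue (?\<rho> v) e" for e
        using eigenvalue_nonneg[OF \<rho> that hermitian_eigenvalue_real[OF \<rho> \<rho>_herm that]]
        by (simp add: nonneg_coeff_set_def)
      thus "?\<rho> v \<in> density_matrices N"
        unfolding density_matrices_def
        by (intro CollectI conjI allI impI \<rho> \<rho>_trace \<rho>_herm)
    qed
    show "coord \<in> density_matrices N \<rightarrow> nonneg_coeff_set N \<Lambda>"
    proof
      fix A assume A: "A \<in> density_matrices N"
      \<comment> \<open>By \<open>surj\<close>, these are the coefficients of \<open>A\<close>
        itself, whose eigenvalues are nonnegative.\<close>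
      have "0 \<le> char_poly_sgn_coeff (?\<rho> (coord A)) i" if "i \<in> {1..N}" for i
        unfolding surj[OF densityD(1-3)[OF A]]
        using that by (intro char_poly_sgn_coeff_nonneg[OF densityD(1)[OF A] densityD(4)[OF A]]) auto
      thus "coord A \<in> nonneg_coeff_set N \<Lambda>"
        by (simp add: nonneg_coeff_set_def coord_def)
    qed
    show "coord (?\<rho> v) = v" if "v \<in> nonneg_coeff_set N \<Lambda>" for v
      using that by (auto simp: coord_def \<rho>_coord nonneg_coeff_set_def)
    show "?\<rho> (coord A) = A" if "A \<in> density_matrices N" for A
      by (rule surj[OF densityD(1-3)[OF that]])
  qed
qed

end
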